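(* Let $p\in\mathcal{D}^{+}(\mathbb{R})\setminus\mathbb{R}^{+}[x]$ and $d=\deg(p)$. Let $\varphi_{0}$ be the least positive argument of all non-zero (complex) roots of $p$. Then $$\deg_{+}(p)\leq\Big\lfloor\frac{d}{2}\Big\rfloor\Big(\Big\lceil\frac{\pi}{\varphi_{0}}\Big\rceil-2\Big)+d.$$
   Context: $\mathbb{R}^{+}[x]$ is the set of real polynomials with all coefficients non-negative. $\mathcal{D}^{+}(\mathbb{R})=\{0\}\cup\{f\in\mathbb{R}[x] : f(a)>0 \text{ for all } a\in(0,\infty)\}$. For $0\neq p\in\mathbb{R}[x]$, $\deg_{+}(p)$ is the least possible degree of a non-zero polynomial in $\mathbb{R}^{+}[x]$ divisible by $p$ (and $\infty$ if none exists). Arguments of non-zero complex numbers are taken in $(-\pi,\pi]$. *)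

theory Defs
  imports
    Complex_Main
    "HOL-Computational_Algebra.Polynomial"
    "HOL-Library.Extended_Nat"
    "HOL-Library.Extended_Real"
begin

definition nonneg_polys :: "real poly set" where
  "nonneg_polys = {f. \<forall>i. coeff f i \<ge> 0}"

definition positive_polys :: "real poly set" where
  "positive_polys = {0} \<union> {f. \<forall>a\<in>{0<..}. poly f a > 0}"

text \<open>
  The infimum of the empty set in \<^typ>\<open>enat\<close> is \<open>\<infinity>\<close>, and every non-empty set of
  extended naturals has a least element, so the infimum is the minimum whenever one exists.
  The notion is only meaningful for \<open>p \<noteq> 0\<close>.
\<close>
definition deg_plus :: "real poly \<Rightarrow> enat" where
  "deg_plus p = (INF f \<in> {f. f \<in> nonneg_polys \<and> f \<noteq> 0 \<and> p dvd f}. enat (degree f))"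

definition complex_roots :: "real poly \<Rightarrow> complex set" where
  "complex_roots p = {z. poly (map_poly complex_of_real p) z = 0}"

text \<open>
  \<^const>\<open>Arg\<close> takes values in \<open>(-pi, pi]\<close>. For \<open>p \<noteq> 0\<close> the set is finite;
  for \<open>p \<in> positive_polys - nonneg_polys\<close> it is also non-empty, because such a polynomial has a
  non-real root, so that \<^const>\<open>Min\<close> is its least element.
\<close>
definition least_pos_arg :: "real poly \<Rightarrow> real" where
  "least_pos_arg p = Min {Arg z | z. z \<in> complex_roots p \<and> z \<noteq> 0 \<and> Arg z > 0}"

end

(* A non-real root r cis \<theta> of p contributes the factor x^2 - 2 r cos \<theta> x + r^2. With n = \<lceil>pi / \<theta>\<rceil>,
   multiplying it by \<Sum>k<n-1. sin ((k+1) \<theta>) (x/r)^k telescopes, by the three-term recurrence for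
   sin (k \<theta>), to a polynomial whose only non-zero coefficients are positive multiples of sin \<theta>,
   -sin (n \<theta>) and sin ((n-1) \<theta>). As (n-1) \<theta> < pi \<le> n \<theta>, these are non-negative. The multiplier
   has degree n - 2 \<le> \<lceil>pi / \<phi>\<^sub>0\<rceil> - 2, there are at most \<lfloor>d/2\<rfloor> such factors, and the remaining
   linear factors x - a have a \<le> 0. *)
theory Submission
  imports Defs "HOL-Computational_Algebra.Fundamental_Theorem_Algebra"
begin

section \<open>Closure properties of polynomials with non-negative coefficients\<close>

lemma nonneg_polys_mult:
  assumes "f \<in> nonneg_polys" "g \<in> nonneg_polys"
  shows "f * g \<in> nonneg_polys"
  using assms by (auto simp: nonneg_polys_def coeff_mult intro!: sum_nonneg)

lemma nonneg_polys_pCons: "0 \<le> a \<Longrightarrow> f \<in> nonneg_polys \<Longrightarrow> pCons a f \<in> nonneg_polys"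
  by (auto simp: nonneg_polys_def coeff_pCons split: nat.split)

lemma zero_in_nonneg_polys: "0 \<in> nonneg_polys"
  by (simp add: nonneg_polys_def)

section \<open>The multiplier for a single conjugate pair of roots\<close>

lemma sin_Suc_Suc_mult:
  "sin (real (Suc (Suc i)) * \<theta>) = 2 * cos \<theta> * sin (real (Suc i) * \<theta>) - sin (real i * \<theta>)"
proof -
  have *: "real (Suc (Suc i)) * \<theta> = real (Suc i) * \<theta> + \<theta>" "real i * \<theta> = real (Suc i) * \<theta> - \<theta>"
    by (simp_all add: algebra_simps)
  show ?thesis unfolding * sin_add sin_diff by simp
qed

text \<open>The quadratic has the roots \<open>r cis \<theta>\<close> and
  \<open>r cis (-\<theta>)\<close>. \<open>N\<close> is only an upper bound for the optimal index,
  so that one \<open>N\<close> can later serve all roots of a polynomial.\<close>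

lemma quadratic_nonneg_multiple:
  fixes r \<theta> :: real and N :: nat
  assumes r: "0 < r" and \<theta>: "0 < \<theta>" "\<theta> < pi" and N: "pi \<le> real N * \<theta>"
  obtains m where "m \<in> nonneg_polys" "m \<noteq> 0" "degree m \<le> N - 2"
    "[:r\<^sup>2, - (2 * r * cos \<theta>), 1:] * m \<in> nonneg_polys"
proof -
  \<comment> \<open>Minimality of \<open>n\<close> keeps \<open>k * \<theta>\<close> within [0, pi)
    for all \<open>k < n\<close>, where the sine is non-negative.\<close>
  define n where "n = (LEAST n. pi \<le> real n * \<theta>)"
  have n: "pi \<le> real n * \<theta>" unfolding n_def using N by (rule LeastI)
  have nN: "n \<le> N" unfolding n_def using N by (rule Least_le)
  have less: "real k * \<theta> < pi" if "k < n" for k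
    using not_less_Least[of k "\<lambda>n. pi \<le> real n * \<theta>"] that by (auto simp: n_def)
  have "n \<noteq> 0" "n \<noteq> 1" using n \<theta> by (auto intro!: Nat.gr0I)
  then have n2: "2 \<le> n" by simp
  define s where "s k = sin (real k * \<theta>)" for k
  have s_nonneg: "0 \<le> s k" if "k < n" for k
    unfolding s_def using less[OF that] \<theta> by (intro sin_ge_zero) auto
  have s1: "0 < s 1" unfolding s_def using \<theta> by (simp add: sin_gt_zero)
  have s0: "s 0 = 0" by (simp add: s_def)
  \<comment> \<open>\<open>n * \<theta>\<close> lies in [pi, 2 pi), as
    \<open>(n - 1) * \<theta>\<close> and \<open>\<theta>\<close> are both below pi.\<close>
  have sn: "s n \<le> 0"
  proof -
    have "real n * \<theta> = real (n - 1) * \<theta> + \<theta>" using n2 by (simp add: algebra_simps of_nat_diff)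
    then have "real n * \<theta> < 2 * pi" using less[of "n - 1"] n2 \<theta> by simp
    then show ?thesis unfolding s_def using n sin_le_zero by simp
  qed
  have rec: "s (Suc (Suc i)) = 2 * cos \<theta> * s (Suc i) - s i" for i
    unfolding s_def by (rule sin_Suc_Suc_mult)
  define m where "m = (\<Sum>k<n-1. monom (s (Suc k) / r ^ k) k)"
  have cm: "coeff m i = (if i < n - 1 then s (Suc i) / r ^ i else 0)" for i
    unfolding m_def by (simp add: coeff_sum if_distrib sum.delta cong: if_cong)
  have "m \<in> nonneg_polys"
    using s_nonneg r by (auto simp: nonneg_polys_def cm)
  moreover have "m \<noteq> 0"
  proof -
    have "coeff m 0 \<noteq> 0" using n2 s1 by (simp add: cm)
    then show ?thesis by force
  qed
  moreover have "degree m \<le> N - 2"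
    using nN n2 by (intro degree_le) (auto simp: cm)
  moreover have "[:r\<^sup>2, - (2 * r * cos \<theta>), 1:] * m \<in> nonneg_polys"
  proof -
    \<comment> \<open>Without truncation, coefficient \<open>i \<ge> 1\<close> would be a power of
      \<open>r\<close> times \<open>s (i+1) - 2 cos \<theta> s i + s (i-1)\<close>, which is 0.
      Since \<open>m\<close> stops at degree \<open>n - 2\<close>, the exceptions are
      \<open>i = 0\<close>, \<open>i = n - 1\<close> and \<open>i = n\<close>.\<close>
    have "0 \<le> coeff ([:r\<^sup>2, - (2 * r * cos \<theta>), 1:] * m) i" for i
    proof -
      consider "i = 0" | "i = 1" | j where "i = Suc (Suc j)" by (metis One_nat_def not0_implies_Suc)
      then show ?thesis
      proof cases
        case 1
        then show ?thesis using n2 s1 by (simp add: cm)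
      next
        case 2
        have c: "coeff ([:r\<^sup>2, - (2 * r * cos \<theta>), 1:] * m) i = r\<^sup>2 * coeff m 1 - 2 * r * cos \<theta> * coeff m 0"
          using 2 by simp
        have s2: "s 2 = 2 * cos \<theta> * s 1" using rec[of 0] s0 by (simp add: numeral_2_eq_2)
        show ?thesis
        \<comment> \<open>For \<open>n = 2\<close> the multiplier is constant, so the truncation
          already affects \<open>i = 1 = n - 1\<close>.\<close>
        proof (cases "n = 2")
          case True
          then have "coeff ([:r\<^sup>2, - (2 * r * cos \<theta>), 1:] * m) i = - (r * s 2)"
            unfolding c s2 by (simp add: cm)
          then show ?thesis using sn True r by (simp add: mult_nonneg_nonpos)
        next
          case False
          then have "coeff ([:r\<^sup>2, - (2 * r * cos \<theta>), 1:] * m) i = 0"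
            unfolding c using n2 s2 r by (simp add: cm power2_eq_square numeral_2_eq_2)
          then show ?thesis by simp
        qed
      next
        case (3 j)
        have c: "coeff ([:r\<^sup>2, - (2 * r * cos \<theta>), 1:] * m) i =
            r\<^sup>2 * coeff m (Suc (Suc j)) - 2 * r * cos \<theta> * coeff m (Suc j) + coeff m j"
          using 3 by simp
        \<comment> \<open>In terms of \<open>i = j + 2\<close>: below the truncation,
          \<open>i = n - 1\<close>, \<open>i = n\<close> (the leading coefficient), and beyond the
          degree.\<close>
        consider "Suc (Suc j) < n - 1" | "Suc (Suc j) = n - 1" | "Suc j = n - 1" | "n - 1 \<le> j"
          by linarith
        then show ?thesis
        proof cases
          case 1
          then show ?thesis unfolding c using r rec[of "Suc j"]
            by (simp add: cm power2_eq_square field_simps)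
        next
          case 2
          have "coeff ([:r\<^sup>2, - (2 * r * cos \<theta>), 1:] * m) i = - s n / r ^ j"
          proof -
            have "n = Suc (Suc (Suc j))" using 2 by simp
            then show ?thesis
              unfolding c using r by (simp add: cm rec[of "Suc j"] field_simps)
          qed
          then show ?thesis using sn r by (simp add: divide_nonpos_pos)
        next
          case 3
          then show ?thesis unfolding c using r s_nonneg[of "Suc j"] by (simp add: cm)
        next
          case 4
          then show ?thesis unfolding c by (simp add: cm)
        qed
      qed
    qed
    then show ?thesis by (simp add: nonneg_polys_def)
  qed
  ultimately show thesis by (rule that)
qed

section \<open>Real factors from complex roots, and induction over them\<close>

lemma map_poly_of_real_mult:
  "map_poly of_real (p * q) = map_poly of_real p * (map_poly of_real q :: complex poly)"
  by (rule poly_eqI) (simp add: coeff_map_poly coeff_mult)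

lemma map_poly_of_real_add:
  "map_poly of_real (p + q) = map_poly of_real p + (map_poly of_real q :: complex poly)"
  by (rule poly_eqI) (simp add: coeff_map_poly)

lemma poly_map_poly_of_real:
  "poly (map_poly of_real p) (complex_of_real x) = of_real (poly p x)"
  by (induction p) (simp_all add: map_poly_pCons)

lemma poly_map_poly_of_real_cnj:
  "poly (map_poly complex_of_real p) (cnj z) = cnj (poly (map_poly complex_of_real p) z)"
  by (induction p) (simp_all add: map_poly_pCons)

lemma Arg_upper_half_plane:
  assumes "0 < Im z"
  shows "0 < Arg z" "Arg z < pi"
proof -
  have z: "z \<noteq> 0" using assms by auto
  have s: "0 < sin (Arg z)" using assms z by (simp add: sin_Arg)
  have b: "- pi < Arg z" "Arg z \<le> pi" using Arg_bounded by auto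
  show "0 < Arg z"
  proof (rule ccontr)
    assume "\<not> 0 < Arg z"
    then have "0 \<le> sin (- Arg z)" using b by (intro sin_ge_zero) auto
    then show False using s by simp
  qed
  show "Arg z < pi"
    using b s by (cases "Arg z = pi") auto
qed

text \<open>The quadratic is (x - z)(x - cnj z). The remainder of \<open>p\<close> modulo it is a
  real polynomial \<open>a + b x\<close> vanishing at the non-real \<open>z\<close>, which forces
  \<open>b = 0\<close> and then \<open>a = 0\<close>.\<close>

lemma real_quadratic_dvd:
  assumes root: "poly (map_poly complex_of_real p) z = 0" and im: "Im z \<noteq> 0"
  shows "[:(cmod z)\<^sup>2, - 2 * Re z, 1:] dvd p"
proof -
  define Q where "Q = [:(cmod z)\<^sup>2, - 2 * Re z, 1:]"
  define R where "R = p mod Q"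
  have Q0: "Q \<noteq> 0" by (simp add: Q_def)
  have "degree Q = 2" by (simp add: Q_def)
  then have "degree R < 2"
    unfolding R_def using degree_mod_less[OF Q0, of p] by auto
  then have "R = [:coeff R 0, coeff R 1:]"
    by (intro poly_eqI) (auto simp: coeff_pCons coeff_eq_0 split: nat.split)
  then obtain a b where R: "R = [:a, b:]" by blast
  have Qz: "poly (map_poly complex_of_real Q) z = 0"
    using cmod_power2[of z]
    by (simp add: Q_def map_poly_pCons complex_eq_iff power2_eq_square algebra_simps)
  have "p = Q * (p div Q) + R" by (simp add: R_def)
  then have "poly (map_poly complex_of_real R) z = 0"
    using root Qz by (metis add.left_neutral map_poly_of_real_add map_poly_of_real_mult mult_zero_left
        poly_add poly_mult)
  then have "complex_of_real a + z * complex_of_real b = 0"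
    by (simp add: R map_poly_pCons)
  then have "a = 0" "b = 0" using im by (auto simp: complex_eq_iff)
  then have "p mod Q = 0" using R by (simp add: R_def)
  then show ?thesis by (simp add: Q_def mod_eq_0_iff_dvd)
qed

text \<open>Factors are split off by strong induction on the degree: a real root costs nothing, a
  conjugate pair uses up two degrees and costs at most \<open>N - 2\<close>. With \<open>N\<close>
  fixed, both hypotheses pass to the cofactor.\<close>

lemma nonneg_multiple_exists:
  fixes p :: "real poly"
  assumes "\<And>a. 0 < a \<Longrightarrow> 0 < poly p a" and "2 \<le> N"
    and "\<And>z. z \<in> complex_roots p \<Longrightarrow> 0 < Im z \<Longrightarrow> pi \<le> real N * Arg z"
  shows "\<exists>q. q \<in> nonneg_polys \<and> q \<noteq> 0 \<and> degree q \<le> degree p div 2 * (N - 2) \<and> p * q \<in> nonneg_polys"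
  using assms(1,3)
proof (induction "degree p" arbitrary: p rule: less_induct)
  case less
  have one: "1 \<in> (nonneg_polys :: real poly set)" by (simp add: nonneg_polys_def)
  have p0: "p \<noteq> 0" using less.prems(1)[of 1] by auto
  have factor: "complex_roots p' \<subseteq> complex_roots p" if "p = Q * p'" for Q p'
    using that by (auto simp: complex_roots_def map_poly_of_real_mult)
  show ?case
  proof (cases "degree p = 0")
    case True
    then obtain c where "p = [:c:]" by (rule degree_eq_zeroE)
    then have "p \<in> nonneg_polys"
      using less.prems(1)[of 1] by (simp add: nonneg_polys_pCons zero_in_nonneg_polys)
    then show ?thesis using one by (intro exI[of _ 1]) auto
  next
    case False
    then have "\<not> constant (poly (map_poly complex_of_real p))"
      by (simp add: constant_degree degree_map_poly)
    then obtain z where z: "poly (map_poly complex_of_real p) z = 0"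
      using fundamental_theorem_of_algebra by blast
    show ?thesis
    proof (cases "Im z = 0")
      case True
      define a where "a = Re z"
      have "z = of_real a" using True by (simp add: a_def complex_eq_iff)
      then have root: "poly p a = 0" using z by (simp add: poly_map_poly_of_real)
      then have a: "a \<le> 0" using less.prems(1)[of a] by force
      obtain p' where p': "p = [:- a, 1:] * p'" using root by (auto simp: poly_eq_0_iff_dvd)
      then have "p' \<noteq> 0" using p0 by auto
      then have deg: "degree p = Suc (degree p')" unfolding p' by (subst degree_mult_eq) auto
      have "\<exists>q. q \<in> nonneg_polys \<and> q \<noteq> 0 \<and> degree q \<le> degree p' div 2 * (N - 2) \<and> p' * q \<in> nonneg_polys"
      proof (rule less.hyps)
        show "0 < poly p' x" if "0 < x" for x
        proof -
          have "0 < (x - a) * poly p' x" using less.prems(1)[OF that] by (simp add: p' algebra_simps)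
          then show ?thesis using that a by (simp add: zero_less_mult_iff)
        qed
      qed (use deg less.prems(2) factor[OF p'] in auto)
      then obtain q where q: "q \<in> nonneg_polys" "q \<noteq> 0" "degree q \<le> degree p' div 2 * (N - 2)"
        "p' * q \<in> nonneg_polys" by blast
      have "degree p' div 2 * (N - 2) \<le> degree p div 2 * (N - 2)"
        by (intro mult_right_mono div_le_mono) (auto simp: deg)
      moreover have "[:- a, 1:] \<in> nonneg_polys"
        using a by (simp add: nonneg_polys_pCons zero_in_nonneg_polys)
      then have "p * q \<in> nonneg_polys"
        using nonneg_polys_mult[OF _ q(4)] by (simp only: p' mult.assoc)
      ultimately show ?thesis using q le_trans by blast
    next
      case False
      \<comment> \<open>Of the conjugate pair, the member with argument in (0, pi).\<close>
      define w where "w = (if 0 < Im z then z else cnj z)"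
      have w: "poly (map_poly complex_of_real p) w = 0" "0 < Im w"
        using z False by (auto simp: w_def poly_map_poly_of_real_cnj)
      define r where "r = cmod w"
      define \<theta> where "\<theta> = Arg w"
      define Q where "Q = [:r\<^sup>2, - (2 * r * cos \<theta>), 1:]"
      have r: "0 < r" using w(2) by (auto simp: r_def)
      have re: "Re w = r * cos \<theta>" unfolding r_def \<theta>_def by (metis Re_rcis rcis_cmod_Arg)
      have "Q dvd p" using real_quadratic_dvd[of p w] w by (simp add: Q_def r_def[symmetric] re mult.assoc)
      then obtain p' where p': "p = Q * p'" by blast
      have "Q \<noteq> 0" "degree Q = 2" by (simp_all add: Q_def)
      moreover have "p' \<noteq> 0" using p0 p' by auto
      ultimately have deg: "degree p = 2 + degree p'" unfolding p' by (simp add: degree_mult_eq)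
      \<comment> \<open>Completing the square; positivity of \<open>p\<close> on the positive reals
        then passes to \<open>p'\<close>.\<close>
      have Qpos: "0 < poly Q x" for x
      proof -
        have "poly Q x = (x - Re w)\<^sup>2 + (Im w)\<^sup>2"
          using cmod_power2[of w] re by (simp add: Q_def r_def[symmetric] power2_eq_square algebra_simps)
        then show ?thesis using w(2) by (simp add: add_nonneg_pos)
      qed
      have "\<exists>q. q \<in> nonneg_polys \<and> q \<noteq> 0 \<and> degree q \<le> degree p' div 2 * (N - 2) \<and> p' * q \<in> nonneg_polys"
      proof (rule less.hyps)
        show "0 < poly p' x" if "0 < x" for x
          using less.prems(1)[OF that] Qpos[of x] by (simp add: p' zero_less_mult_iff)
      qed (use deg less.prems(2) factor[OF p'] in auto)
      then obtain q where q: "q \<in> nonneg_polys" "q \<noteq> 0" "degree q \<le> degree p' div 2 * (N - 2)"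
        "p' * q \<in> nonneg_polys" by blast
      have "pi \<le> real N * \<theta>" using less.prems(2) w by (simp add: \<theta>_def complex_roots_def)
      then obtain m where m: "m \<in> nonneg_polys" "m \<noteq> 0" "degree m \<le> N - 2" "Q * m \<in> nonneg_polys"
        using quadratic_nonneg_multiple[OF r, of \<theta> N] Arg_upper_half_plane[OF w(2)]
        unfolding Q_def \<theta>_def by blast
      have "p * (m * q) \<in> nonneg_polys"
        using nonneg_polys_mult[OF m(4) q(4)] by (simp add: p' ac_simps)
      moreover have "degree (m * q) \<le> degree p div 2 * (N - 2)"
        using m(2,3) q(2,3) by (simp add: degree_mult_eq deg)
      ultimately show ?thesis
        using m q by (intro exI[of _ "m * q"]) (auto intro: nonneg_polys_mult)
    qed
  qed
qed

section \<open>The degree bound in terms of the least positive argument\<close>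

theorem theorem2p12:
  fixes p :: "real poly" and d :: nat and \<phi>\<^sub>0 :: real
  assumes "p \<in> positive_polys - nonneg_polys"
    and "d = degree p"
    and "\<phi>\<^sub>0 = least_pos_arg p"
  shows "ereal_of_enat (deg_plus p) \<le>
    ereal (real_of_int (\<lfloor>real d / 2\<rfloor> * (\<lceil>pi / \<phi>\<^sub>0\<rceil> - 2) + int d))"
proof -
  have notin: "p \<notin> nonneg_polys" using assms(1) by simp
  then have p0: "p \<noteq> 0" using zero_in_nonneg_polys by auto
  have pos: "0 < poly p a" if "0 < a" for a
    using assms(1) p0 that by (auto simp: positive_polys_def)
  \<comment> \<open>Otherwise the root condition holds vacuously with \<open>N = 2\<close>, and the
    multiplier is a positive constant, so \<open>p\<close> itself would have non-negative
    coefficients.\<close>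
  have "\<exists>w\<in>complex_roots p. 0 < Im w"
  proof (rule ccontr)
    assume "\<not> ?thesis"
    then obtain q where q: "q \<in> nonneg_polys" "q \<noteq> 0" "degree q \<le> degree p div 2 * (2 - 2)"
      "p * q \<in> nonneg_polys"
      using nonneg_multiple_exists[OF pos, of 2] by blast
    then obtain c where c: "q = [:c:]" by (auto elim: degree_eq_zeroE)
    then have "0 < c" using q(1,2) by (auto simp: nonneg_polys_def dest: spec[of _ 0])
    then have "p \<in> nonneg_polys" using q(4) c by (auto simp: nonneg_polys_def zero_le_mult_iff)
    then show False using notin by simp
  qed
  then obtain w where w: "w \<in> complex_roots p" "0 < Im w" by blast
  define A where "A = {Arg z | z. z \<in> complex_roots p \<and> z \<noteq> 0 \<and> Arg z > 0}"
  have "map_poly complex_of_real p \<noteq> 0" using p0 by (simp add: map_poly_eq_0_iff)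
  then have "finite (complex_roots p)" unfolding complex_roots_def by (rule poly_roots_finite)
  then have fin: "finite A" unfolding A_def by simp
  have inA: "Arg z \<in> A" if "z \<in> complex_roots p" "0 < Im z" for z
    using that Arg_upper_half_plane(1)[of z] unfolding A_def by auto
  have phi: "\<phi>\<^sub>0 = Min A" unfolding assms(3) least_pos_arg_def A_def ..
  have "\<phi>\<^sub>0 \<in> A" unfolding phi using fin inA[OF w] by (intro Min_in) auto
  then have phi0: "0 < \<phi>\<^sub>0" by (auto simp: A_def)
  have phi_le: "\<phi>\<^sub>0 \<le> Arg z" if "z \<in> complex_roots p" "0 < Im z" for z
    unfolding phi using fin inA[OF that] by (rule Min_le)
  \<comment> \<open>Negative real roots put pi into \<open>A\<close>, but \<open>w\<close> has a
    smaller argument. Hence the ceiling is at least 2, and the natural number \<open>N - 2\<close>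
    agrees with the integer difference.\<close>
  then have "\<phi>\<^sub>0 < pi" using w Arg_upper_half_plane(2)[OF w(2)] by fastforce
  then have "1 < pi / \<phi>\<^sub>0" using phi0 by simp
  then have two: "2 \<le> \<lceil>pi / \<phi>\<^sub>0\<rceil>" by linarith
  define N where "N = nat \<lceil>pi / \<phi>\<^sub>0\<rceil>"
  have N2: "2 \<le> N" and NI: "int N = \<lceil>pi / \<phi>\<^sub>0\<rceil>" using two unfolding N_def by linarith+
  have "pi / \<phi>\<^sub>0 \<le> real N" using NI by (metis le_of_int_ceiling of_int_of_nat_eq)
  then have piN: "pi \<le> real N * \<phi>\<^sub>0" using phi0 by (simp add: field_simps)
  have "pi \<le> real N * Arg z" if "z \<in> complex_roots p" "0 < Im z" for z
    using piN mult_left_mono[OF phi_le[OF that], of "real N"] by simp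
  then obtain q where q: "q \<in> nonneg_polys" "q \<noteq> 0" "degree q \<le> d div 2 * (N - 2)" "p * q \<in> nonneg_polys"
    using nonneg_multiple_exists[OF pos N2] assms(2) by blast
  \<comment> \<open>\<open>p * q\<close> is one of the candidates over which the infimum is
    taken.\<close>
  have "deg_plus p \<le> enat (degree (p * q))"
    unfolding deg_plus_def using q p0 by (intro INF_lower) auto
  also have "\<dots> \<le> enat (d div 2 * (N - 2) + d)"
    using q p0 by (simp add: degree_mult_eq assms(2))
  finally have "ereal_of_enat (deg_plus p) \<le> ereal_of_enat (enat (d div 2 * (N - 2) + d))"
    by (simp only: ereal_of_enat_le_iff)
  also have "\<dots> = ereal (real (d div 2 * (N - 2) + d))" by simp
  also have "real (d div 2 * (N - 2) + d) = real_of_int (int (d div 2) * (int N - 2) + int d)"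
    using N2 by (simp add: of_nat_diff)
  also have "int (d div 2) = \<lfloor>real d / 2\<rfloor>"
    by (metis floor_divide_of_nat_eq of_nat_numeral)
  finally show ?thesis by (simp only: NI)
qed

end
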